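(* Let $A$ be a finite alphabet. For every two-dimensional cellular automaton $F$ on $A^{\mathbb{Z}^2}$ and every bi-invariant probability measure $\mu$ (invariant under $F$ and under all shifts), $$\limsup_{n\to\infty}\frac{h_\mu(\mathcal{S}_n,F)}{n}\le 8\cdot\liminf_{n\to\infty}\frac{h_\mu(\mathcal{S}_n,F)}{n}.$$
   Context: $A^{\mathbb{Z}^2}$ carries the product of discrete topologies and its Borel $\sigma$-algebra. The shifts are $\sigma^v(x)_u=x_{u+v}$, $u,v\in\mathbb{Z}^2$. A cellular automaton is a continuous self-map of $A^{\mathbb{Z}^2}$ commuting with all shifts. $E_n=\{(i,j)\in\mathbb{Z}^2: -n\le i,j\le n\}$, and $\mathcal{S}_n$ is the finite clopen partition of $A^{\mathbb{Z}^2}$ according to the pattern $x|_{E_n}$. $h_\mu(\mathcal{P},F)=\lim_{N}\frac1N H_\mu(\bigvee_{i=0}^{N-1}F^{-i}\mathcal{P})$ with $H_\mu$ the Shannon entropy of a partition. *)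

theory Defs
  imports "HOL-Probability.Probability"
begin

text \<open>Configurations over a finite alphabet are functions \<^typ>\<open>int \<times> int \<Rightarrow> 'a\<close>. The library topology on
  functions is the product topology, so with a discrete \<^typ>\<open>'a\<close> both
  \<^const>\<open>continuous_on\<close> and \<^const>\<open>borel\<close> on configurations have the intended meaning.\<close>

type_synonym 'a config = "int \<times> int \<Rightarrow> 'a"

definition shift :: "int \<times> int \<Rightarrow> 'a config \<Rightarrow> 'a config" where
  "shift v x = (\<lambda>u. x (u + v))"

definition cellular_automaton ::
    "('a :: {finite, discrete_topology} config \<Rightarrow> 'a config) \<Rightarrow> bool" where
  "cellular_automaton F \<longleftrightarrow> continuous_on UNIV F \<and> (\<forall>v. F \<circ> shift v = shift v \<circ> F)"

definition invariant_measure :: "('b \<Rightarrow> 'b) \<Rightarrow> 'b measure \<Rightarrow> bool" where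
  "invariant_measure T M \<longleftrightarrow> T \<in> measurable M M \<and> distr M M T = M"

definition bi_invariant_prob ::
    "('a :: {finite, discrete_topology} config \<Rightarrow> 'a config) \<Rightarrow> 'a config measure \<Rightarrow> bool" where
  "bi_invariant_prob F \<mu> \<longleftrightarrow>
     sets \<mu> = sets borel \<and> prob_space \<mu> \<and>
     invariant_measure F \<mu> \<and> (\<forall>v. invariant_measure (shift v) \<mu>)"

definition square :: "nat \<Rightarrow> (int \<times> int) set" where
  "square n = {- int n..int n} \<times> {- int n..int n}"

definition square_partition :: "nat \<Rightarrow> 'a config set set" where
  "square_partition n = range (\<lambda>p. {x. \<forall>u\<in>square n. x u = p u})"

definition preimage_partition :: "('b \<Rightarrow> 'b) \<Rightarrow> 'b set set \<Rightarrow> 'b set set" where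
  "preimage_partition T P = (\<lambda>C. T -` C) ` P - {{}}"

definition partition_join :: "'i set \<Rightarrow> ('i \<Rightarrow> 'b set set) \<Rightarrow> 'b set set" where
  "partition_join I P = {(\<Inter>i\<in>I. C i) | C. \<forall>i\<in>I. C i \<in> P i} - {{}}"

text \<open>Entropy is measured in nats; null cells contribute \<open>0\<close>, matching the usual convention
  \<open>0 log 0 = 0\<close>.\<close>

definition partition_entropy :: "'b measure \<Rightarrow> 'b set set \<Rightarrow> real" where
  "partition_entropy M P = - (\<Sum>C\<in>P. measure M C * ln (measure M C))"

definition dynamical_entropy :: "'b measure \<Rightarrow> 'b set set \<Rightarrow> ('b \<Rightarrow> 'b) \<Rightarrow> real" where
  "dynamical_entropy M P T =
     lim (\<lambda>N. partition_entropy M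
                (partition_join {..<N} (\<lambda>i. preimage_partition (T ^^ i) P)) / real N)"

end

theory Submission
  imports Defs
begin

text \<open>Let \<open>F\<close> have radius \<open>r \<le> n\<close>. The pattern on \<open>E\<^sub>m\<close> at time \<open>0\<close> and the history of the boundary layer of
  width \<open>r\<close> of \<open>E\<^sub>m\<close> determine the history of all of \<open>E\<^sub>m\<close>. The initial pattern has bounded entropy,
  so it does not contribute to the entropy rate, and the layer is covered by at most \<open>8m/n + 12\<close>
  translates of \<open>E\<^sub>n\<close> centred on the boundary of \<open>E\<^sub>m\<close>. Subadditivity and shift invariance give
  \<open>h(E\<^sub>m) \<le> (8m/n + 12) h(E\<^sub>n)\<close>. Dividing by \<open>m\<close> and letting \<open>m \<rightarrow> \<infinity>\<close> bounds the upper limit by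
  \<open>8 h(E\<^sub>n)/n\<close> for every \<open>n \<ge> max r 1\<close>.\<close>

section \<open>Subadditive sequences\<close>

lemma subadditive_bound:
  fixes a :: "nat \<Rightarrow> real"
  assumes sub: "\<And>m n. a (m + n) \<le> a m + a n"
  shows "a (q * m + r) \<le> real q * a m + a r"
proof (induction q)
  case (Suc q)
  have "a (Suc q * m + r) \<le> a m + a (q * m + r)"
    using sub[of m "q * m + r"] by (simp add: add.assoc)
  with Suc show ?case by (simp add: algebra_simps)
qed simp

text \<open>Fekete's lemma. Division with remainder by a fixed \<open>m\<close> bounds
  \<open>a n / n\<close> by \<open>a m / m\<close> plus an error of order \<open>1 / n\<close>, so
  no quotient is below the upper limit. Nonnegativity makes the infimum genuine.\<close>

lemma fekete:
  fixes a :: "nat \<Rightarrow> real"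
  assumes sub: "\<And>m n. a (m + n) \<le> a m + a n" and nonneg: "\<And>n. 0 \<le> a n"
  shows "(\<lambda>n. a n / real n) \<longlonglongrightarrow> (INF n\<in>{1..}. a n / real n)"
proof -
  define L where "L = (INF n\<in>{1..}. a n / real n)"
  have bdd: "bdd_below ((\<lambda>n. a n / real n) ` {1..})"
    by (rule bdd_belowI2[of _ 0]) (simp add: nonneg)
  have lower: "L \<le> a n / real n" if "n \<ge> 1" for n
    unfolding L_def using that by (intro cINF_lower[OF bdd]) auto
  have upper: "eventually (\<lambda>n. a n / real n < z) sequentially" if "z > L" for z
  proof -
    have "\<exists>m\<in>{1..}. a m / real m < z"
      using that unfolding L_def by (subst (asm) cINF_less_iff[OF _ bdd]) auto
    then obtain m where m: "m \<ge> 1" "a m / real m < z" by auto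
    \<comment> \<open>\<open>C\<close> bounds \<open>a (n mod m)\<close> for all \<open>n\<close> at
      once: each remainder contributes one of the nonnegative summands.\<close>
    define C where "C = (\<Sum>r<m. a r)"
    have bound: "a n / real n \<le> a m / real m + C / real n" if n: "n \<ge> 1" for n
    proof -
      have "a n \<le> real (n div m) * a m + a (n mod m)"
        using subadditive_bound[of a "n div m" m "n mod m", OF sub] by simp
      also have "a (n mod m) \<le> C"
        unfolding C_def using m by (intro member_le_sum) (auto simp: nonneg)
      also have "real (n div m) * a m \<le> real n / real m * a m"
        using m by (intro mult_right_mono nonneg) (simp add: of_nat_div_le_of_nat)
      finally show ?thesis
        using n m by (simp add: field_simps)
    qed
    have "(\<lambda>n. a m / real m + C / real n) \<longlonglongrightarrow> a m / real m + 0"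
      by (intro tendsto_intros lim_const_over_n)
    then have "eventually (\<lambda>n. a m / real m + C / real n < z) sequentially"
      using m by (intro order_tendstoD(2)) auto
    then show ?thesis
      using eventually_ge_at_top[of 1]
      by eventually_elim (use bound in fastforce)
  qed
  show ?thesis
    unfolding L_def[symmetric]
  proof (rule order_tendstoI)
    fix z assume "z < L"
    then show "eventually (\<lambda>n. z < a n / real n) sequentially"
      by (intro eventually_mono[OF eventually_ge_at_top[of 1]]) (use lower in fastforce)
  qed (rule upper)
qed

section \<open>Shannon entropy of finitely valued random variables\<close>

text \<open>\<open>Y\<close> factors through \<open>X\<close>: evaluate \<open>Y\<close> at the
  point that \<open>inv X\<close> picks in the fiber. Data processing then applies.\<close>

lemma (in information_space) entropy_determined_le:
  assumes X: "simple_function M X" and det: "\<And>x y. X x = X y \<Longrightarrow> Y x = Y y"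
  shows "\<H>(Y) \<le> \<H>(X)"
proof -
  have "Y = (\<lambda>p. Y (inv X p)) \<circ> X"
  proof
    fix x
    have "X x = X (inv X (X x))" by (simp add: f_inv_into_f)
    then show "Y x = ((\<lambda>p. Y (inv X p)) \<circ> X) x"
      unfolding comp_apply by (rule det)
  qed
  then show ?thesis
    using entropy_data_processing[OF X, of "\<lambda>p. Y (inv X p)"] by metis
qed

text \<open>Chain rule, together with the fact that conditioning does not increase entropy.\<close>

lemma (in information_space) entropy_Pair_le:
  assumes "simple_function M X" "simple_function M Y"
  shows "\<H>(\<lambda>x. (X x, Y x)) \<le> \<H>(X) + \<H>(Y)"
  using entropy_chain_rule[OF assms] conditional_entropy_less_eq_entropy[OF assms(2,1)] by simp

lemma (in information_space) entropy_eq_sum_log_prob: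
  assumes "simple_function M X"
  shows "\<H>(X) = - (\<Sum>p\<in>X ` space M. prob (X -` {p} \<inter> space M) * log b (prob (X -` {p} \<inter> space M)))"
  by (intro entropy_simple_distributed simple_distributedI assms) auto

text \<open>Invariance gives \<open>X\<close> and \<open>X \<circ> T\<close> the same distribution,
  and entropy depends on the distribution alone.\<close>

lemma (in information_space) entropy_invariant:
  assumes X: "simple_function M X" and T: "invariant_measure T M"
  shows "simple_function M (X \<circ> T)" and "\<H>(X \<circ> T) = \<H>(X)"
proof -
  have meas: "T \<in> measurable M M" and dist: "distr M M T = M"
    using T by (auto simp: invariant_measure_def)
  show sf: "simple_function M (X \<circ> T)"
    by (rule simple_function_comp[OF meas X, unfolded comp_def[symmetric]])
  have TM: "T x \<in> space M" if "x \<in> space M" for x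
    using meas that by (rule measurable_space)
  have prob_eq: "prob ((X \<circ> T) -` {p} \<inter> space M) = prob (X -` {p} \<inter> space M)" for p
  proof -
    have "prob (X -` {p} \<inter> space M) = measure (distr M M T) (X -` {p} \<inter> space M)"
      by (simp add: dist)
    also have "\<dots> = prob (T -` (X -` {p} \<inter> space M) \<inter> space M)"
      using X by (intro measure_distr meas simple_functionD)
    also have "T -` (X -` {p} \<inter> space M) \<inter> space M = (X \<circ> T) -` {p} \<inter> space M"
      using TM by auto
    finally show ?thesis by simp
  qed
  have "(\<Sum>p\<in>(X \<circ> T) ` space M. prob (X -` {p} \<inter> space M) * log b (prob (X -` {p} \<inter> space M)))
      = (\<Sum>p\<in>X ` space M. prob (X -` {p} \<inter> space M) * log b (prob (X -` {p} \<inter> space M)))"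
  \<comment> \<open>\<open>T\<close> may fail to be onto, so \<open>X \<circ> T\<close> may miss
    values of \<open>X\<close>. Such values have probability zero and add nothing.\<close>
  proof (rule sum.mono_neutral_left)
    show "finite (X ` space M)" using X by (rule simple_functionD)
    show "(X \<circ> T) ` space M \<subseteq> X ` space M" using TM by auto
    show "\<forall>p\<in>X ` space M - (X \<circ> T) ` space M.
        prob (X -` {p} \<inter> space M) * log b (prob (X -` {p} \<inter> space M)) = 0"
    proof
      fix p assume "p \<in> X ` space M - (X \<circ> T) ` space M"
      then have "(X \<circ> T) -` {p} \<inter> space M = {}" by blast
      with prob_eq[of p] show "prob (X -` {p} \<inter> space M) * log b (prob (X -` {p} \<inter> space M)) = 0"
        by simp
    qed
  qed
  then show "\<H>(X \<circ> T) = \<H>(X)"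
    unfolding entropy_eq_sum_log_prob[OF X] entropy_eq_sum_log_prob[OF sf] prob_eq by simp
qed

section \<open>Topology of the configuration space and local rules\<close>

lemma compact_UNIV_config: "compact (UNIV :: 'a :: {finite, discrete_topology} config set)"
proof -
  have "compact_space (product_topology (\<lambda>_. euclidean :: 'a topology) (UNIV :: (int \<times> int) set))"
    unfolding compact_space_product_topology
    by (auto simp: compact_space_def finite_imp_compact)
  then show ?thesis
    by (simp add: euclidean_product_topology compact_space_def)
qed

lemma finite_square [simp]: "finite (square n)"
  by (simp add: square_def)

lemma mem_square: "u \<in> square n \<longleftrightarrow> \<bar>fst u\<bar> \<le> int n \<and> \<bar>snd u\<bar> \<le> int n"
  by (cases u) (auto simp: square_def)

lemma finite_subset_square:
  assumes "finite W"
  obtains r where "W \<subseteq> square r"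
proof -
  have "\<exists>r. W \<subseteq> square r"
    using assms
  proof (induction W)
    case (insert u W)
    then obtain r where "W \<subseteq> square r" by blast
    then have "insert u W \<subseteq> square (r + nat \<bar>fst u\<bar> + nat \<bar>snd u\<bar>)"
      by (auto simp: mem_square subset_iff; fastforce)
    then show ?case by blast
  qed simp
  then show thesis using that by blast
qed

lemma open_cylinder:
  assumes "finite W"
  shows "open {y :: 'a :: discrete_topology config. \<forall>u\<in>W. y u = x u}"
  using product_topology_basis'[OF assms, of "\<lambda>u. {x u}" "\<lambda>u. u"] by (simp add: Topological_Spaces.open_discrete)

lemma open_contains_cylinder:
  assumes "open U" "x \<in> U"
  obtains W where "finite W" "{y :: 'a :: discrete_topology config. \<forall>u\<in>W. y u = x u} \<subseteq> U"
proof -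
  have "openin (product_topology (\<lambda>_. euclidean :: 'a topology) UNIV) U"
    using assms by (simp add: euclidean_product_topology)
  from product_topology_open_contains_basis[OF this assms(2)]
  obtain X where X: "x \<in> (\<Pi>\<^sub>E i\<in>UNIV. X i)" "finite {i. X i \<noteq> UNIV}" "(\<Pi>\<^sub>E i\<in>UNIV. X i) \<subseteq> U"
    by auto
  have "{y. \<forall>u\<in>{i. X i \<noteq> UNIV}. y u = x u} \<subseteq> (\<Pi>\<^sub>E i\<in>UNIV. X i)"
    using X(1) by (force simp: PiE_iff)
  then show thesis
    by (intro that[OF X(2)] subset_trans[OF _ X(3)])
qed

text \<open>The compactness half of the Curtis-Hedlund-Lyndon theorem. By continuity,
  \<open>F x v\<close> depends near each \<open>x\<close> on a finite window. Finitely many of these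
  cylinders cover the space, and one square contains all their windows.\<close>

lemma continuous_local_rule:
  fixes F :: "'a :: {finite, discrete_topology} config \<Rightarrow> 'a config"
  assumes "continuous_on UNIV F"
  obtains r where "\<And>x y. (\<And>u. u \<in> square r \<Longrightarrow> x u = y u) \<Longrightarrow> F x v = F y v"
proof -
  have cont: "continuous_on UNIV (\<lambda>x. F x v)"
    using assms by (rule continuous_on_product_then_coordinatewise)
  have "\<exists>W. finite W \<and> (\<forall>y. (\<forall>u\<in>W. y u = x u) \<longrightarrow> F y v = F x v)" for x
  proof -
    have "open ((\<lambda>y. F y v) -` {F x v})"
      using cont by (intro open_vimage Topological_Spaces.open_discrete)
    then obtain W where "finite W" "{y. \<forall>u\<in>W. y u = x u} \<subseteq> (\<lambda>y. F y v) -` {F x v}"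
      by (rule open_contains_cylinder) auto
    then show ?thesis by (intro exI[of _ W]) auto
  qed
  then obtain W where finW: "\<And>x. finite (W x)"
    and W: "\<And>x y. (\<forall>u\<in>W x. y u = x u) \<Longrightarrow> F y v = F x v"
    by metis
  obtain D where D: "finite D" "UNIV \<subseteq> (\<Union>x\<in>D. {y. \<forall>u\<in>W x. y u = x u})"
    by (rule compactE_image[OF compact_UNIV_config, of UNIV "\<lambda>x. {y. \<forall>u\<in>W x. y u = x u}"])
      (use open_cylinder finW in auto)
  obtain r where r: "(\<Union>x\<in>D. W x) \<subseteq> square r"
    using finite_subset_square[of "\<Union>x\<in>D. W x"] D(1) finW by auto
  show thesis
  proof (rule that)
    fix x y :: "'a config"
    assume eq: "\<And>u. u \<in> square r \<Longrightarrow> x u = y u"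
    \<comment> \<open>Both \<open>x\<close> and \<open>y\<close> agree with the center
      \<open>z\<close> on its window, so both values are compared with \<open>F z v\<close>.\<close>
    obtain z where z: "z \<in> D" "\<forall>u\<in>W z. x u = z u"
      using D(2) by blast
    have "W z \<subseteq> square r"
      using r z(1) by blast
    then have "\<forall>u\<in>W z. y u = z u"
      using eq z(2) by (metis subsetD)
    from W[OF z(2)] W[OF this] show "F x v = F y v" by simp
  qed
qed

section \<open>Space-time patterns and their entropy\<close>

lemma shift_apply: "shift v x u = x (u + v)"
  by (simp add: shift_def)

locale bi_invariant_ca =
  fixes F :: "'a :: {finite, discrete_topology} config \<Rightarrow> 'a config"
    and \<mu> :: "'a config measure"
  assumes ca: "cellular_automaton F" and inv: "bi_invariant_prob F \<mu>"
begin

text \<open>Base \<open>exp 1\<close> turns the logarithm into \<open>ln\<close>, the unit of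
  \<open>partition_entropy\<close>.\<close>

sublocale information_space \<mu> "exp 1"
  using inv by (auto simp: information_space_def information_space_axioms_def bi_invariant_prob_def)

lemma sets_\<mu>: "sets \<mu> = sets borel"
  using inv by (simp add: bi_invariant_prob_def)

lemma space_\<mu> [simp]: "space \<mu> = UNIV"
  using sets_eq_imp_space_eq[OF sets_\<mu>] by simp

lemma invariant_shift: "invariant_measure (shift v) \<mu>"
  using inv unfolding bi_invariant_prob_def by blast

lemma invariant_F: "invariant_measure F \<mu>"
  using inv by (simp add: bi_invariant_prob_def)

lemma F_shift: "F (shift v x) = shift v (F x)"
proof -
  have "F \<circ> shift v = shift v \<circ> F"
    using ca unfolding cellular_automaton_def by blast
  from fun_cong[OF this, of x] show ?thesis by simp
qed

lemma funpow_shift: "(F ^^ i) (shift v x) = shift v ((F ^^ i) x)"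
  by (induction i) (simp_all add: F_shift)

lemma continuous_funpow: "continuous_on UNIV (F ^^ i)"
proof (induction i)
  case (Suc i)
  have "continuous_on UNIV F"
    using ca by (simp add: cellular_automaton_def)
  then show ?case
    unfolding funpow.simps
    by (intro continuous_on_compose Suc) (rule continuous_on_subset, auto)
qed (simp add: id_def)

lemma invariant_funpow: "invariant_measure (F ^^ i) \<mu>"
proof (induction i)
  case (Suc i)
  then have i: "F ^^ i \<in> measurable \<mu> \<mu>" "distr \<mu> \<mu> (F ^^ i) = \<mu>"
    and F: "F \<in> measurable \<mu> \<mu>" "distr \<mu> \<mu> F = \<mu>"
    using invariant_F by (auto simp: invariant_measure_def)
  show ?case
    unfolding invariant_measure_def funpow.simps
    using measurable_comp[OF i(1) F(1)] distr_distr[OF F(1) i(1)] unfolding i F by simp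
qed (simp add: invariant_measure_def id_def distr_id)

text \<open>Partitions are replaced by random variables on arbitrary sets of (time, cell) pairs. The
  fixed value that \<open>restrict\<close> gives outside \<open>S\<close> makes equality of patterns
  mean agreement on \<open>S\<close>.\<close>

definition pattern :: "(nat \<times> int \<times> int) set \<Rightarrow> 'a config \<Rightarrow> nat \<times> int \<times> int \<Rightarrow> 'a" where
  "pattern S x = restrict (\<lambda>(i, u). (F ^^ i) x u) S"

lemma pattern_eq_iff:
  "pattern S x = pattern S y \<longleftrightarrow> (\<forall>(i, u)\<in>S. (F ^^ i) x u = (F ^^ i) y u)"
  by (auto simp: pattern_def restrict_def fun_eq_iff split: if_splits)

lemma simple_function_pattern:
  assumes "finite S"
  shows "simple_function \<mu> (pattern S)"
  unfolding simple_function_def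
proof (intro conjI ballI)
  have "range (pattern S) \<subseteq> PiE S (\<lambda>_. UNIV)"
    by (auto simp: pattern_def)
  then show "finite (pattern S ` space \<mu>)"
    using finite_subset[OF _ finite_PiE[OF assms finite, of "\<lambda>_. UNIV"]] by simp
  fix p assume "p \<in> pattern S ` space \<mu>"
  then obtain y where "p = pattern S y" by auto
  then have eq: "pattern S -` {p} \<inter> space \<mu> = (\<Inter>(i, u)\<in>S. (\<lambda>x. (F ^^ i) x u) -` {(F ^^ i) y u})"
    by (auto simp: pattern_eq_iff)
  have "open ((\<lambda>x. (F ^^ i) x u) -` {(F ^^ i) y u})" for i u
    by (intro open_vimage Topological_Spaces.open_discrete
        continuous_on_product_then_coordinatewise[OF continuous_funpow])
  then have "open (pattern S -` {p} \<inter> space \<mu>)"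
    unfolding eq using assms by (intro open_INT) auto
  then show "pattern S -` {p} \<inter> space \<mu> \<in> sets \<mu>"
    by (simp add: sets_\<mu>)
qed

definition pattern_entropy :: "(nat \<times> int \<times> int) set \<Rightarrow> real" where
  "pattern_entropy S = entropy_Pow (pattern S)"

lemma pattern_entropy_determined_le:
  assumes "finite S"
    and "\<And>x y. (\<And>i u. (i, u) \<in> S \<Longrightarrow> (F ^^ i) x u = (F ^^ i) y u) \<Longrightarrow> pattern T x = pattern T y"
  shows "pattern_entropy T \<le> pattern_entropy S"
  unfolding pattern_entropy_def
proof (rule entropy_determined_le)
  show "simple_function \<mu> (pattern S)"
    using assms(1) by (rule simple_function_pattern)
  fix x y assume "pattern S x = pattern S y"
  then show "pattern T x = pattern T y"
    by (intro assms(2)) (auto simp: pattern_eq_iff)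
qed

text \<open>The two patterns jointly determine the pattern on the union.\<close>

lemma pattern_entropy_Un:
  assumes "finite S" "finite T"
  shows "pattern_entropy (S \<union> T) \<le> pattern_entropy S + pattern_entropy T"
proof -
  note sf = simple_function_pattern[OF assms(1)] simple_function_pattern[OF assms(2)]
  have "pattern_entropy (S \<union> T) \<le> entropy_Pow (\<lambda>x. (pattern S x, pattern T x))"
    unfolding pattern_entropy_def
    by (rule entropy_determined_le[OF simple_function_Pair[OF sf]]) (auto simp: pattern_eq_iff)
  also have "\<dots> \<le> entropy_Pow (pattern S) + entropy_Pow (pattern T)"
    using sf by (rule entropy_Pair_le)
  finally show ?thesis by (simp add: pattern_entropy_def)
qed

text \<open>As \<open>S \<union> S = S\<close>, subadditivity says that the entropy is at most twice
  itself.\<close>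

lemma pattern_entropy_nonneg: "finite S \<Longrightarrow> 0 \<le> pattern_entropy S"
  using pattern_entropy_Un[of S S] by simp

text \<open>\<open>T\<close> is the base of the induction on \<open>V\<close>; in the application it
  carries the initial pattern.\<close>

lemma pattern_entropy_UN:
  assumes "finite V" "finite T" "\<And>v. v \<in> V \<Longrightarrow> finite (S v)"
  shows "pattern_entropy (T \<union> (\<Union>v\<in>V. S v)) \<le> pattern_entropy T + (\<Sum>v\<in>V. pattern_entropy (S v))"
  using assms(1,3)
proof (induction V)
  case (insert v V)
  have "T \<union> (\<Union>w\<in>insert v V. S w) = S v \<union> (T \<union> (\<Union>w\<in>V. S w))" by auto
  then have "pattern_entropy (T \<union> (\<Union>w\<in>insert v V. S w))
      \<le> pattern_entropy (S v) + pattern_entropy (T \<union> (\<Union>w\<in>V. S w))"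
    using insert assms(2) by (simp only:) (rule pattern_entropy_Un, auto)
  with insert show ?case by simp
qed simp

text \<open>The pattern on the translated set is determined by the pattern on \<open>S\<close> read
  after \<open>shift v\<close> and \<open>F ^^ k\<close>, and both maps preserve entropy.\<close>

lemma pattern_entropy_translate_le:
  assumes "finite S"
  shows "pattern_entropy ((\<lambda>(i, u). (i + k, u + v)) ` S) \<le> pattern_entropy S"
proof -
  let ?X = "pattern S \<circ> (F ^^ k)"
  note sf = simple_function_pattern[OF assms]
  have app: "(F ^^ i) ((F ^^ k) (shift v x)) u = (F ^^ (i + k)) x (u + v)" for i x u
    by (simp add: funpow_shift shift_apply funpow_add)
  have X: "simple_function \<mu> ?X" "entropy_Pow (?X) = entropy_Pow (pattern S)"
    using entropy_invariant[OF sf invariant_funpow] by auto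
  have Y: "simple_function \<mu> (?X \<circ> shift v)" "entropy_Pow (?X \<circ> shift v) = entropy_Pow (?X)"
    using entropy_invariant[OF X(1) invariant_shift] by auto
  have "pattern_entropy ((\<lambda>(i, u). (i + k, u + v)) ` S) \<le> entropy_Pow (?X \<circ> shift v)"
    unfolding pattern_entropy_def
    by (rule entropy_determined_le[OF Y(1)]) (auto simp: pattern_eq_iff app)
  then show ?thesis using X Y by (simp add: pattern_entropy_def)
qed

section \<open>Entropy rate of the square partitions\<close>

definition square_entropy :: "nat \<Rightarrow> nat \<Rightarrow> real" where
  "square_entropy n N = pattern_entropy ({..<N} \<times> square n)"

text \<open>The last \<open>N\<close> of \<open>M + N\<close> time steps are the first
  \<open>N\<close> translated by \<open>M\<close> in time.\<close>

lemma square_entropy_subadditive: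
  "square_entropy n (M + N) \<le> square_entropy n M + square_entropy n N"
proof -
  let ?T = "(\<lambda>(i, u). (i + M, u + 0)) ` ({..<N} \<times> square n)"
  have "{..<M + N} \<times> square n = {..<M} \<times> square n \<union> ?T"
  proof (intro equalityI subsetI)
    fix s assume s: "s \<in> {..<M + N} \<times> square n"
    obtain i u where "s = (i, u)" by (cases s)
    show "s \<in> {..<M} \<times> square n \<union> ?T"
    proof (cases "i < M")
      case False
      with s have "s \<in> ?T"
        by (intro image_eqI[of _ _ "(i - M, u)"]) (auto simp: \<open>s = (i, u)\<close>)
      then show ?thesis ..
    qed (use s in \<open>auto simp: \<open>s = (i, u)\<close>\<close>)
  qed auto
  then have "square_entropy n (M + N) \<le> square_entropy n M + pattern_entropy ?T"
    unfolding square_entropy_def by (simp only:) (rule pattern_entropy_Un, auto)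
  also have "pattern_entropy ?T \<le> square_entropy n N"
    unfolding square_entropy_def by (intro pattern_entropy_translate_le) simp
  finally show ?thesis by simp
qed

text \<open>Choosing a cell at each time amounts to fixing a space-time pattern. The empty sets
  removed from the join correspond to patterns that no configuration attains.\<close>

lemma partition_join_square:
  "partition_join {..<N} (\<lambda>i. preimage_partition (F ^^ i) (square_partition n)) =
     (\<lambda>p. pattern ({..<N} \<times> square n) -` {p}) ` range (pattern ({..<N} \<times> square n))"
  (is "?J = ?R")
proof (intro equalityI subsetI)
  fix A assume "A \<in> ?J"
  then obtain C where A: "A = (\<Inter>i\<in>{..<N}. C i)" "A \<noteq> {}"
    and C: "\<forall>i\<in>{..<N}. C i \<in> preimage_partition (F ^^ i) (square_partition n)"
    by (auto simp: partition_join_def)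
  have "\<exists>p. i < N \<longrightarrow> C i = {x. \<forall>u\<in>square n. (F ^^ i) x u = p u}" for i
  proof (cases "i < N")
    case True
    then have "C i \<in> preimage_partition (F ^^ i) (square_partition n)"
      using C by simp
    then obtain p where "C i = (F ^^ i) -` {x. \<forall>u\<in>square n. x u = p u}"
      unfolding preimage_partition_def square_partition_def by blast
    then show ?thesis by (intro exI[of _ p]) simp
  qed simp
  then have "\<forall>i. \<exists>p. i < N \<longrightarrow> C i = {x. \<forall>u\<in>square n. (F ^^ i) x u = p u}" ..
  from choice[OF this]
  obtain p where p: "\<And>i. i < N \<Longrightarrow> C i = {x. \<forall>u\<in>square n. (F ^^ i) x u = p i u}"
    by blast
  from A obtain x where x: "x \<in> A" by auto
  \<comment> \<open>A nonempty cell is the fiber through any of its points, so the orbit of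
    \<open>x\<close> can replace the chosen \<open>p\<close>.\<close>
  have "A = pattern ({..<N} \<times> square n) -` {pattern ({..<N} \<times> square n) x}"
    using x unfolding A by (auto simp: pattern_eq_iff p)
  then show "A \<in> ?R" by blast
next
  fix A assume "A \<in> ?R"
  then obtain x where A: "A = pattern ({..<N} \<times> square n) -` {pattern ({..<N} \<times> square n) x}"
    by blast
  define C where "C i = (F ^^ i) -` {y. \<forall>u\<in>square n. y u = (F ^^ i) x u}" for i
  have "A = (\<Inter>i\<in>{..<N}. C i)"
    by (auto simp: A C_def pattern_eq_iff)
  moreover have "\<forall>i\<in>{..<N}. C i \<in> preimage_partition (F ^^ i) (square_partition n)"
  proof
    fix i
    \<comment> \<open>The point \<open>x\<close> keeps \<open>C i\<close> nonempty, so the cell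
      survives the removal of \<open>{}\<close>.\<close>
    have "x \<in> C i" by (simp add: C_def)
    then show "C i \<in> preimage_partition (F ^^ i) (square_partition n)"
      unfolding C_def preimage_partition_def square_partition_def by blast
  qed
  moreover have "A \<noteq> {}" by (auto simp: A)
  ultimately show "A \<in> ?J"
    unfolding partition_join_def by blast
qed

lemma partition_entropy_square:
  "partition_entropy \<mu> (partition_join {..<N} (\<lambda>i. preimage_partition (F ^^ i) (square_partition n)))
     = square_entropy n N"
proof -
  let ?X = "pattern ({..<N} \<times> square n)"
  have "inj_on (\<lambda>p. ?X -` {p}) (range ?X)"
    by (intro inj_onI) blast
  then show ?thesis
    unfolding partition_join_square partition_entropy_def square_entropy_def pattern_entropy_def
    by (subst entropy_eq_sum_log_prob[OF simple_function_pattern]) (simp_all add: sum.reindex log_def)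
qed

text \<open>Fekete's lemma shows that the sequence converges, so the \<open>lim\<close> defining
  \<open>dynamical_entropy\<close> is its actual limit.\<close>

lemma square_entropy_tendsto:
  "(\<lambda>N. square_entropy n N / real N) \<longlonglongrightarrow> dynamical_entropy \<mu> (square_partition n) F"
proof -
  have "(\<lambda>N. square_entropy n N / real N) \<longlonglongrightarrow> (INF N\<in>{1..}. square_entropy n N / real N)"
    using square_entropy_subadditive
    by (rule fekete) (simp add: square_entropy_def pattern_entropy_nonneg)
  then show ?thesis
    unfolding dynamical_entropy_def partition_entropy_square by (simp add: limI)
qed

lemma dynamical_entropy_nonneg: "0 \<le> dynamical_entropy \<mu> (square_partition n) F"
  by (rule LIMSEQ_le_const[OF square_entropy_tendsto])
    (simp add: square_entropy_def pattern_entropy_nonneg)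

section \<open>Radius of the automaton and screening by the boundary layer\<close>

definition radius :: "nat \<Rightarrow> bool" where
  "radius r \<longleftrightarrow> (\<forall>x y v. (\<forall>u\<in>square r. x (v + u) = y (v + u)) \<longrightarrow> F x v = F y v)"

text \<open>The local rule at the origin is carried to every cell by commutation with shifts, so a
  single \<open>r\<close> serves all cells.\<close>

lemma ex_radius: "\<exists>r. radius r"
proof -
  have "continuous_on UNIV F"
    using ca by (simp add: cellular_automaton_def)
  then obtain r where r: "\<And>x y. (\<And>u. u \<in> square r \<Longrightarrow> x u = y u) \<Longrightarrow> F x 0 = F y 0"
    using continuous_local_rule[of F 0] by blast
  have "F x v = F y v" if "\<forall>u\<in>square r. x (v + u) = y (v + u)" for x y v
    using r[of "shift v x" "shift v y"] that by (simp add: F_shift shift_apply add.commute)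
  then show ?thesis unfolding radius_def by blast
qed

text \<open>The boundary layer of width \<open>r\<close> screens the interior of the square from its exterior, so its
  history and the initial pattern determine the whole history of the square.\<close>

lemma boundary_determines:
  assumes r: "radius r"
    and init: "\<And>u. u \<in> square m \<Longrightarrow> x u = y u"
    and boundary: "\<And>i u. i < N \<Longrightarrow> u \<in> square m \<Longrightarrow> int m < \<bar>fst u\<bar> + int r \<or> int m < \<bar>snd u\<bar> + int r
        \<Longrightarrow> (F ^^ i) x u = (F ^^ i) y u"
    and "i < N" "u \<in> square m"
  shows "(F ^^ i) x u = (F ^^ i) y u"
  using assms(4,5)
proof (induction i arbitrary: u)
  case 0
  then show ?case using init by simp
next
  case (Suc i)
  show ?case
  proof (cases "int m < \<bar>fst u\<bar> + int r \<or> int m < \<bar>snd u\<bar> + int r")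
    case True
    then show ?thesis using boundary Suc.prems by blast
  next
    case False
    \<comment> \<open>Off the layer both coordinates of \<open>u\<close> are at most
      \<open>m - r\<close> in absolute value, so the whole neighborhood of \<open>u\<close> stays in
      \<open>square m\<close>.\<close>
    have "(F ^^ i) x (u + w) = (F ^^ i) y (u + w)" if "w \<in> square r" for w
      using that False Suc.prems(1) by (intro Suc.IH) (auto simp: mem_square)
    then have "F ((F ^^ i) x) u = F ((F ^^ i) y) u"
      using r unfolding radius_def by blast
    then show ?thesis by simp
  qed
qed

end

section \<open>Covering the boundary layer by translated squares\<close>

text \<open>Centers lie at spacing \<open>n\<close> on the lines through the four sides of
  \<open>square m\<close>. Rounding a negative coordinate down can give
  \<open>- (m div n) - 1\<close>; the range is made symmetric.\<close>

definition boundary_centers :: "nat \<Rightarrow> nat \<Rightarrow> (int \<times> int) set" where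
  "boundary_centers m n = (let K = {- int (m div n) - 1..int (m div n) + 1} in
     (\<lambda>k. (int m, k * int n)) ` K \<union> (\<lambda>k. (- int m, k * int n)) ` K \<union>
     (\<lambda>k. (k * int n, int m)) ` K \<union> (\<lambda>k. (k * int n, - int m)) ` K)"

lemma finite_boundary_centers [simp]: "finite (boundary_centers m n)"
  by (simp add: boundary_centers_def Let_def)

text \<open>Source of the constant 8: four sides with \<open>2 * (m div n) + 3\<close> centers
  each.\<close>

lemma card_boundary_centers: "real (card (boundary_centers m n)) \<le> 8 * real m / real n + 12"
proof -
  let ?K = "{- int (m div n) - 1..int (m div n) + 1}"
  have "card (boundary_centers m n) \<le> card ?K + card ?K + card ?K + card ?K"
    unfolding boundary_centers_def Let_def
    by (intro card_Un_le[THEN order_trans] add_mono card_image_le) auto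
  also have "\<dots> = 8 * (m div n) + 12" by simp
  finally have "real (card (boundary_centers m n)) \<le> 8 * real (m div n) + 12"
    by linarith
  moreover have "real (m div n) \<le> real m / real n" by (rule of_nat_div_le_of_nat)
  ultimately show ?thesis by simp
qed

text \<open>One coordinate of a layer cell is within \<open>r \<le> n\<close> of \<open>m\<close> or
  \<open>- m\<close>. Rounding the other one down to a multiple of \<open>n\<close> moves it by less
  than \<open>n\<close>.\<close>

lemma boundary_covered:
  assumes u: "u \<in> square m" and n: "0 < n" "r \<le> n"
    and bd: "int m < \<bar>fst u\<bar> + int r \<or> int m < \<bar>snd u\<bar> + int r"
  shows "\<exists>v\<in>boundary_centers m n. u - v \<in> square n"
proof -
  obtain a b where ab: "u = (a, b)" by (cases u)
  let ?K = "{- int (m div n) - 1..int (m div n) + 1}"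
  have K: "c div int n \<in> ?K" "\<bar>c - c div int n * int n\<bar> \<le> int n" if "\<bar>c\<bar> \<le> int m" for c
  proof -
    have "c div int n \<le> int m div int n"
      using that n by (intro zdiv_mono1) auto
    \<comment> \<open>Negated, this bounds \<open>c\<close> from below by a multiple of
      \<open>n\<close>, which gives the lower end of the index range.\<close>
    moreover have "int m < (int m div int n + 1) * int n"
      using n pos_mod_bound[of "int n" "int m"] div_mult_mod_eq[of "int m" "int n"]
      unfolding distrib_right by linarith
    then have "(- (int m div int n) - 1) * int n \<le> c"
      using that by (simp add: algebra_simps)
    then have "- (int m div int n) - 1 \<le> c div int n"
      using zdiv_mono1[of "(- (int m div int n) - 1) * int n" c "int n"] n by simp
    ultimately show "c div int n \<in> ?K" by (simp add: zdiv_int)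
    show "\<bar>c - c div int n * int n\<bar> \<le> int n"
      unfolding minus_div_mult_eq_mod
      using n pos_mod_bound[of "int n" c] pos_mod_sign[of "int n" c] by linarith
  qed
  have abm: "\<bar>a\<bar> \<le> int m" "\<bar>b\<bar> \<le> int m"
    using u by (auto simp: ab mem_square)
  consider "int m < a + int r" | "int m < - a + int r" | "int m < b + int r" | "int m < - b + int r"
    using bd by (fastforce simp: ab abs_if split: if_splits)
  then show ?thesis
  proof cases
    case 1
    then have "u - (int m, b div int n * int n) \<in> square n"
      using K(2)[OF abm(2)] abm n by (auto simp: ab mem_square)
    then show ?thesis using K(1)[OF abm(2)] unfolding boundary_centers_def Let_def by blast
  next
    case 2
    then have "u - (- int m, b div int n * int n) \<in> square n"
      using K(2)[OF abm(2)] abm n by (auto simp: ab mem_square)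
    then show ?thesis using K(1)[OF abm(2)] unfolding boundary_centers_def Let_def by blast
  next
    case 3
    then have "u - (a div int n * int n, int m) \<in> square n"
      using K(2)[OF abm(1)] abm n by (auto simp: ab mem_square)
    then show ?thesis using K(1)[OF abm(1)] unfolding boundary_centers_def Let_def by blast
  next
    case 4
    then have "u - (a div int n * int n, - int m) \<in> square n"
      using K(2)[OF abm(1)] abm n by (auto simp: ab mem_square)
    then show ?thesis using K(1)[OF abm(1)] unfolding boundary_centers_def Let_def by blast
  qed
qed

section \<open>Comparing the entropies of two squares\<close>

context bi_invariant_ca
begin

text \<open>Screening meets covering: the pattern at time 0 is paid once, independently of
  \<open>N\<close>, and each translate of \<open>square n\<close> costs at most
  \<open>square_entropy n N\<close>.\<close>

lemma square_entropy_le: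
  assumes r: "radius r" and n: "0 < n" "r \<le> n"
  shows "square_entropy m N
    \<le> pattern_entropy ({0} \<times> square m) + real (card (boundary_centers m n)) * square_entropy n N"
proof -
  let ?V = "boundary_centers m n"
  \<comment> \<open>The summand \<open>0\<close> matches the form of
    \<open>pattern_entropy_translate_le\<close> with no time shift.\<close>
  let ?S = "\<lambda>v. (\<lambda>(i, u). (i + 0, u + v)) ` ({..<N} \<times> square n)"
  let ?T = "{0} \<times> square m :: (nat \<times> int \<times> int) set"
  have "square_entropy m N \<le> pattern_entropy (?T \<union> (\<Union>v\<in>?V. ?S v))"
    unfolding square_entropy_def
  proof (rule pattern_entropy_determined_le)
    fix x y
    assume eq: "\<And>i u. (i, u) \<in> ?T \<union> (\<Union>v\<in>?V. ?S v) \<Longrightarrow> (F ^^ i) x u = (F ^^ i) y u"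
    have init: "x u = y u" if "u \<in> square m" for u
      using eq[of 0 u] that by simp
    have boundary: "(F ^^ i) x u = (F ^^ i) y u"
      if i: "i < N" and u: "u \<in> square m" "int m < \<bar>fst u\<bar> + int r \<or> int m < \<bar>snd u\<bar> + int r" for i u
    proof -
      obtain v where v: "v \<in> ?V" "u - v \<in> square n"
        using boundary_covered[OF u(1) n u(2)] by blast
      then have "(i, u) \<in> ?S v"
        using i by (intro image_eqI[of _ _ "(i, u - v)"]) auto
      with v show ?thesis by (intro eq) blast
    qed
    show "pattern ({..<N} \<times> square m) x = pattern ({..<N} \<times> square m) y"
      unfolding pattern_eq_iff using boundary_determines[OF r init boundary] by auto
  qed simp
  also have "\<dots> \<le> pattern_entropy ?T + (\<Sum>v\<in>?V. pattern_entropy (?S v))"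
    by (intro pattern_entropy_UN) auto
  also have "(\<Sum>v\<in>?V. pattern_entropy (?S v)) \<le> (\<Sum>v\<in>?V. square_entropy n N)"
    unfolding square_entropy_def by (intro sum_mono pattern_entropy_translate_le) simp
  finally show ?thesis by simp
qed

lemma dynamical_entropy_square_le:
  assumes "radius r" "0 < n" "r \<le> n"
  shows "dynamical_entropy \<mu> (square_partition m) F
    \<le> (8 * real m / real n + 12) * dynamical_entropy \<mu> (square_partition n) F"
proof -
  let ?c = "pattern_entropy ({0} \<times> square m)" and ?k = "real (card (boundary_centers m n))"
  \<comment> \<open>After division by \<open>N\<close> the cost of the initial pattern vanishes in
    the limit.\<close>
  have "(\<lambda>N. ?c / real N + ?k * (square_entropy n N / real N))
      \<longlonglongrightarrow> 0 + ?k * dynamical_entropy \<mu> (square_partition n) F"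
    by (intro tendsto_intros lim_const_over_n square_entropy_tendsto)
  moreover have "square_entropy m N / real N \<le> ?c / real N + ?k * (square_entropy n N / real N)" for N
    using divide_right_mono[OF square_entropy_le[OF assms, of m N], of "real N"]
    by (simp add: add_divide_distrib)
  ultimately have "dynamical_entropy \<mu> (square_partition m) F
      \<le> 0 + ?k * dynamical_entropy \<mu> (square_partition n) F"
    by (intro LIMSEQ_le[OF square_entropy_tendsto]) auto
  also have "\<dots> \<le> (8 * real m / real n + 12) * dynamical_entropy \<mu> (square_partition n) F"
    using mult_right_mono[OF card_boundary_centers dynamical_entropy_nonneg] by simp
  finally show ?thesis .
qed

lemma limsup_dynamical_entropy_le:
  assumes "radius r" "0 < n" "r \<le> n"
  shows "limsup (\<lambda>m. ereal (dynamical_entropy \<mu> (square_partition m) F / real m))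
    \<le> ereal (8 * (dynamical_entropy \<mu> (square_partition n) F / real n))"
proof -
  let ?h = "\<lambda>n. dynamical_entropy \<mu> (square_partition n) F"
  \<comment> \<open>With \<open>n\<close> fixed, the additive constant 12 fades as \<open>m\<close>
    grows and only the factor 8 remains.\<close>
  have bound: "?h m / real m \<le> 8 * (?h n / real n) + 12 * ?h n / real m" if "m \<ge> 1" for m
    using divide_right_mono[OF dynamical_entropy_square_le[OF assms, of m], of "real m"] that
    by (simp add: field_simps)
  have "(\<lambda>m. 8 * (?h n / real n) + 12 * ?h n / real m) \<longlonglongrightarrow> 8 * (?h n / real n) + 0"
    by (intro tendsto_intros lim_const_over_n)
  then have "limsup (\<lambda>m. ereal (8 * (?h n / real n) + 12 * ?h n / real m)) = ereal (8 * (?h n / real n))"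
    by (intro lim_imp_Limsup) auto
  moreover have "limsup (\<lambda>m. ereal (?h m / real m))
      \<le> limsup (\<lambda>m. ereal (8 * (?h n / real n) + 12 * ?h n / real m))"
    using bound by (intro Limsup_mono eventually_mono[OF eventually_ge_at_top[of 1]]) auto
  ultimately show ?thesis by simp
qed

end

theorem proposition4:
  fixes F :: "'a :: {finite, discrete_topology} config \<Rightarrow> 'a config"
    and \<mu> :: "'a config measure"
  assumes "cellular_automaton F"
    and "bi_invariant_prob F \<mu>"
  shows "limsup (\<lambda>n. ereal (dynamical_entropy \<mu> (square_partition n) F / real n))
           \<le> 8 * liminf (\<lambda>n. ereal (dynamical_entropy \<mu> (square_partition n) F / real n))"
proof -
  interpret bi_invariant_ca F \<mu>
    using assms by unfold_locales
  let ?u = "\<lambda>n. ereal (dynamical_entropy \<mu> (square_partition n) F / real n)"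
  obtain r where r: "radius r" using ex_radius by blast
  \<comment> \<open>\<open>Suc r\<close> ensures both \<open>r \<le> n\<close> and
    \<open>0 < n\<close>. An eventual lower bound of \<open>?u\<close> that does not depend on
    \<open>n\<close> also bounds its lower limit.\<close>
  have "limsup ?u / 8 \<le> ?u n" if "n \<ge> Suc r" for n
    using limsup_dynamical_entropy_le[OF r, of n] that by (simp add: ereal_divide_le_pos)
  then have "limsup ?u / 8 \<le> liminf ?u"
    by (intro Liminf_bounded eventually_mono[OF eventually_ge_at_top[of "Suc r"]])
  then show ?thesis by (simp add: ereal_divide_le_pos)
qed

end
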